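(* Let $k$ be a field and let $(G,m,e,\operatorname{inv},B)$ be an affine Rota--Baxter group over $k$, with descendant affine group $(G,m^B,e,\operatorname{inv}^B)$. Then $(G,m,m^B)$ is an affine skew brace over $k$.
   Context: All $k$-algebras are commutative and unital, with unital homomorphisms; $\mathsf{Alg}_k$ is their category. A Rota--Baxter group is a group $G$ with a map $B:G\to G$ such that $B(g)B(h)=B(gB(g)hB(g)^{-1})$ for all $g,h\in G$. An affine Rota--Baxter group over $k$ is a representable functor $G:\mathsf{Alg}_k\to\mathsf{Set}$ with natural transformations $m:G\times G\to G$ and $B:G\to G$ such that for every $R\in\mathsf{Alg}_k$, $(G(R),m_R,B_R)$ is a Rota--Baxter group; $e$ and $\operatorname{inv}$ denote the unit and inversion of $(G,m)$. Writing $xy=m_R(x,y)$ and $x^{-1}=\operatorname{inv}_R(x)$, the descendant affine group has the same functor $G$ and unit $e$, with $$m^B_R(x,y)=x\,B_R(x)\,y\,B_R(x)^{-1},\qquad \operatorname{inv}^B_R(x)=B_R(x)^{-1}x^{-1}B_R(x),\qquad x,y\in G(R).$$ A skew brace is a triple $(A,\cdot,\circ)$ where $(A,\cdot)$ and $(A,\circ)$ are groups with $a\circ(b\cdot c)=(a\circ b)\cdot a^{-1}\cdot(a\circ c)$ for all $a,b,c$, where $a^{-1}$ is the inverse in $(A,\cdot)$. An affine skew brace over $k$ is a representable functor $\mathcal{A}:\mathsf{Alg}_k\to\mathsf{Set}$ with natural transformations $m_\bullet,m_\circ:\mathcal{A}\times\mathcal{A}\to\mathcal{A}$ such that $(\mathcal{A}(R),m_{\bullet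 R},m_{\circ R})$ is a skew brace for every $R\in\mathsf{Alg}_k$. *)

theory Defs
  imports "HOL-Algebra.Module"
begin

text \<open>
  HOL cannot quantify over all types inside a formula, so the category of commutative unital
  \<open>k\<close>-algebras is taken relative to a universe: its objects are the algebras whose carrier is a
  subset of the type \<open>'u\<close>. That type is arbitrary, and so is the type \<open>'x\<close> of which
  the values of a set-valued functor are subsets. The zero algebra is allowed.
\<close>

definition Alg :: "'k ring \<Rightarrow> ('k, 'u) module set" where
  "Alg k = {R. algebra k R}"

text \<open>
  Homomorphisms are required to be extensional, so that equality of functions is equality
  of homomorphisms.
\<close>

definition alg_hom :: "'k ring \<Rightarrow> ('k, 'u) module \<Rightarrow> ('k, 'u) module \<Rightarrow> ('u \<Rightarrow> 'u) set" where
  "alg_hom k R S =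
    {f \<in> ring_hom R S. f \<in> extensional (carrier R) \<and>
       (\<forall>a\<in>carrier k. \<forall>x\<in>carrier R. f (a \<odot>\<^bsub>R\<^esub> x) = a \<odot>\<^bsub>S\<^esub> f x)}"

record ('k, 'u, 'x) set_functor =
  on_objs :: "('k, 'u) module \<Rightarrow> 'x set"
  on_homs :: "('k, 'u) module \<Rightarrow> ('k, 'u) module \<Rightarrow> ('u \<Rightarrow> 'u) \<Rightarrow> 'x \<Rightarrow> 'x"

text \<open>
  The map \<open>on_homs F R S f\<close> matters only on \<open>on_objs F R\<close>; the same convention holds for
  the components of natural transformations below.
\<close>

definition is_functor :: "'k ring \<Rightarrow> ('k, 'u, 'x) set_functor \<Rightarrow> bool" where
  "is_functor k F \<longleftrightarrow>
     (\<forall>R\<in>Alg k. \<forall>S\<in>Alg k. \<forall>f\<in>alg_hom k R S.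
        on_homs F R S f \<in> on_objs F R \<rightarrow> on_objs F S) \<and>
     (\<forall>R\<in>Alg k. \<forall>x\<in>on_objs F R. on_homs F R R (\<lambda>r\<in>carrier R. r) x = x) \<and>
     (\<forall>R\<in>Alg k. \<forall>S\<in>Alg k. \<forall>T\<in>Alg k. \<forall>f\<in>alg_hom k R S. \<forall>g\<in>alg_hom k S T.
        \<forall>x\<in>on_objs F R.
          on_homs F R T (compose (carrier R) g f) x = on_homs F S T g (on_homs F R S f x))"

definition nat_trans ::
  "'k ring \<Rightarrow> ('k, 'u, 'x) set_functor \<Rightarrow> ('k, 'u, 'y) set_functor
     \<Rightarrow> (('k, 'u) module \<Rightarrow> 'x \<Rightarrow> 'y) \<Rightarrow> bool" where
  "nat_trans k F G \<alpha> \<longleftrightarrow>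
     (\<forall>R\<in>Alg k. \<alpha> R \<in> on_objs F R \<rightarrow> on_objs G R) \<and>
     (\<forall>R\<in>Alg k. \<forall>S\<in>Alg k. \<forall>f\<in>alg_hom k R S. \<forall>x\<in>on_objs F R.
        \<alpha> S (on_homs F R S f x) = on_homs G R S f (\<alpha> R x))"

definition hom_functor ::
  "'k ring \<Rightarrow> ('k, 'u) module \<Rightarrow> ('k, 'u, 'u \<Rightarrow> 'u) set_functor" where
  "hom_functor k A =
     \<lparr>on_objs = (\<lambda>R. alg_hom k A R), on_homs = (\<lambda>R S f \<phi>. compose (carrier A) f \<phi>)\<rparr>"

definition prod_functor ::
  "('k, 'u, 'x) set_functor \<Rightarrow> ('k, 'u, 'y) set_functor \<Rightarrow> ('k, 'u, 'x \<times> 'y) set_functor" where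
  "prod_functor F G =
     \<lparr>on_objs = (\<lambda>R. on_objs F R \<times> on_objs G R),
      on_homs = (\<lambda>R S f. map_prod (on_homs F R S f) (on_homs G R S f))\<rparr>"

definition representable :: "'k ring \<Rightarrow> ('k, 'u, 'x) set_functor \<Rightarrow> bool" where
  "representable k F \<longleftrightarrow>
     is_functor k F \<and>
     (\<exists>A\<in>Alg k. \<exists>\<alpha>. nat_trans k (hom_functor k A) F \<alpha> \<and>
        (\<forall>R\<in>Alg k. bij_betw (\<alpha> R) (alg_hom k A R) (on_objs F R)))"

definition rota_baxter_group :: "'x monoid \<Rightarrow> ('x \<Rightarrow> 'x) \<Rightarrow> bool" where
  "rota_baxter_group G B \<longleftrightarrow>
     group G \<and> B \<in> carrier G \<rightarrow> carrier G \<and>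
     (\<forall>g\<in>carrier G. \<forall>h\<in>carrier G.
        B g \<otimes>\<^bsub>G\<^esub> B h = B (g \<otimes>\<^bsub>G\<^esub> B g \<otimes>\<^bsub>G\<^esub> h \<otimes>\<^bsub>G\<^esub> inv\<^bsub>G\<^esub> (B g)))"

text \<open>\<open>A\<close> and \<open>C\<close> are the groups \<open>(A, \<cdot>)\<close> and \<open>(A, \<circ>)\<close> on one underlying set.\<close>

definition skew_brace :: "'x monoid \<Rightarrow> 'x monoid \<Rightarrow> bool" where
  "skew_brace A C \<longleftrightarrow>
     group A \<and> group C \<and> carrier C = carrier A \<and>
     (\<forall>a\<in>carrier A. \<forall>b\<in>carrier A. \<forall>c\<in>carrier A.
        a \<otimes>\<^bsub>C\<^esub> (b \<otimes>\<^bsub>A\<^esub> c) = (a \<otimes>\<^bsub>C\<^esub> b) \<otimes>\<^bsub>A\<^esub> inv\<^bsub>A\<^esub> a \<otimes>\<^bsub>A\<^esub> (a \<otimes>\<^bsub>C\<^esub> c))"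

definition points ::
  "('k, 'u, 'x) set_functor \<Rightarrow> (('k, 'u) module \<Rightarrow> 'x \<times> 'x \<Rightarrow> 'x)
     \<Rightarrow> (('k, 'u) module \<Rightarrow> 'x) \<Rightarrow> ('k, 'u) module \<Rightarrow> 'x monoid" where
  "points G m e R =
     \<lparr>carrier = on_objs G R, mult = (\<lambda>x y. m R (x, y)), one = e R\<rparr>"

text \<open>
  The unit \<open>e\<close> and inversion \<open>iv\<close> are determined by \<open>m\<close>; the predicate below says that they
  are indeed the unit and inversion of \<open>(G, m)\<close>. Their naturality is not assumed.
\<close>

definition affine_rota_baxter_group ::
  "'k ring \<Rightarrow> ('k, 'u, 'x) set_functor \<Rightarrow> (('k, 'u) module \<Rightarrow> 'x \<times> 'x \<Rightarrow> 'x)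
     \<Rightarrow> (('k, 'u) module \<Rightarrow> 'x) \<Rightarrow> (('k, 'u) module \<Rightarrow> 'x \<Rightarrow> 'x)
     \<Rightarrow> (('k, 'u) module \<Rightarrow> 'x \<Rightarrow> 'x) \<Rightarrow> bool" where
  "affine_rota_baxter_group k G m e iv B \<longleftrightarrow>
     representable k G \<and> nat_trans k (prod_functor G G) G m \<and> nat_trans k G G B \<and>
     (\<forall>R\<in>Alg k. rota_baxter_group (points G m e R) (B R) \<and>
        (\<forall>x\<in>on_objs G R. iv R x = inv\<^bsub>points G m e R\<^esub> x))"

definition descendant_mult ::
  "(('k, 'u) module \<Rightarrow> 'x \<times> 'x \<Rightarrow> 'x) \<Rightarrow> (('k, 'u) module \<Rightarrow> 'x \<Rightarrow> 'x)
     \<Rightarrow> (('k, 'u) module \<Rightarrow> 'x \<Rightarrow> 'x) \<Rightarrow> ('k, 'u) module \<Rightarrow> 'x \<times> 'x \<Rightarrow> 'x" where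
  "descendant_mult m iv B R = (\<lambda>(x, y). m R (m R (m R (x, B R x), y), iv R (B R x)))"

definition descendant_inv ::
  "(('k, 'u) module \<Rightarrow> 'x \<times> 'x \<Rightarrow> 'x) \<Rightarrow> (('k, 'u) module \<Rightarrow> 'x \<Rightarrow> 'x)
     \<Rightarrow> (('k, 'u) module \<Rightarrow> 'x \<Rightarrow> 'x) \<Rightarrow> ('k, 'u) module \<Rightarrow> 'x \<Rightarrow> 'x" where
  "descendant_inv m iv B R x = m R (m R (iv R (B R x), iv R x), B R x)"

definition descendant_affine_group ::
  "('k, 'u, 'x) set_functor \<Rightarrow> (('k, 'u) module \<Rightarrow> 'x \<times> 'x \<Rightarrow> 'x)
     \<Rightarrow> (('k, 'u) module \<Rightarrow> 'x) \<Rightarrow> (('k, 'u) module \<Rightarrow> 'x \<Rightarrow> 'x)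
     \<Rightarrow> (('k, 'u) module \<Rightarrow> 'x \<Rightarrow> 'x)
     \<Rightarrow> ('k, 'u, 'x) set_functor \<times> (('k, 'u) module \<Rightarrow> 'x \<times> 'x \<Rightarrow> 'x)
        \<times> (('k, 'u) module \<Rightarrow> 'x) \<times> (('k, 'u) module \<Rightarrow> 'x \<Rightarrow> 'x)" where
  "descendant_affine_group G m e iv B = (G, descendant_mult m iv B, e, descendant_inv m iv B)"

text \<open>
  The units of the two groups are not part of the data of a skew brace, whereas library
  groups carry theirs; hence the existential quantifiers.
\<close>

definition affine_skew_brace ::
  "'k ring \<Rightarrow> ('k, 'u, 'x) set_functor \<Rightarrow> (('k, 'u) module \<Rightarrow> 'x \<times> 'x \<Rightarrow> 'x)
     \<Rightarrow> (('k, 'u) module \<Rightarrow> 'x \<times> 'x \<Rightarrow> 'x) \<Rightarrow> bool" where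
  "affine_skew_brace k A m m' \<longleftrightarrow>
     representable k A \<and> nat_trans k (prod_functor A A) A m \<and>
     nat_trans k (prod_functor A A) A m' \<and>
     (\<forall>R\<in>Alg k. \<exists>e e'. skew_brace (points A m e R) (points A m' e' R))"

end

theory Submission
  imports Defs
begin

text \<open>
  The Rota--Baxter identity says that \<open>B (x \<circ> y) = B x \<cdot> B y\<close> for the descendant product
  \<open>x \<circ> y = x \<cdot> B x \<cdot> y \<cdot> (B x)\<^sup>-\<^sup>1\<close>. Hence \<open>B\<close> fixes the unit, \<open>\<circ>\<close> is associative, and the right
  inverse \<open>(B x)\<^sup>-\<^sup>1 \<cdot> x\<^sup>-\<^sup>1 \<cdot> B x\<close> of \<open>x\<close> is mapped to \<open>(B x)\<^sup>-\<^sup>1\<close>, which makes it a left inverse.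
  The brace identity holds because \<open>a \<circ> b\<close> is \<open>a\<close> times a conjugate of \<open>b\<close>. Inversion is natural
  because the functor sends algebra maps to group homomorphisms.
\<close>

text \<open>With \<open>g = h = \<one>\<close> in the Rota--Baxter identity the argument on the
  right collapses to \<open>\<one>\<close>, so \<open>B \<one>\<close> is idempotent, and a group
  has no idempotent but its unit.\<close>

lemma rota_baxter_group_one:
  assumes "rota_baxter_group G B"
  shows "B \<one>\<^bsub>G\<^esub> = \<one>\<^bsub>G\<^esub>"
proof -
  interpret group G using assms by (simp add: rota_baxter_group_def)
  have B: "B \<one>\<^bsub>G\<^esub> \<in> carrier G"
    using assms by (auto simp: rota_baxter_group_def)
  have "B \<one>\<^bsub>G\<^esub> \<otimes>\<^bsub>G\<^esub> B \<one>\<^bsub>G\<^esub>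
      = B (\<one>\<^bsub>G\<^esub> \<otimes>\<^bsub>G\<^esub> B \<one>\<^bsub>G\<^esub> \<otimes>\<^bsub>G\<^esub> \<one>\<^bsub>G\<^esub> \<otimes>\<^bsub>G\<^esub> inv\<^bsub>G\<^esub> (B \<one>\<^bsub>G\<^esub>))"
    using assms one_closed unfolding rota_baxter_group_def by blast
  also have "\<dots> = B \<one>\<^bsub>G\<^esub>" using B by simp
  finally show ?thesis using B by (metis r_cancel_one)
qed

lemma skew_brace_descendant:
  fixes A (structure)
  assumes rb: "rota_baxter_group A B"
    and carr: "carrier C = carrier A" and one: "\<one>\<^bsub>C\<^esub> = \<one>"
    and mult: "\<And>x y. x \<in> carrier A \<Longrightarrow> y \<in> carrier A \<Longrightarrow> x \<otimes>\<^bsub>C\<^esub> y = x \<otimes> B x \<otimes> y \<otimes> inv (B x)"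
  shows "skew_brace A C"
proof -
  interpret group A using rb by (simp add: rota_baxter_group_def)
  have B [simp]: "B x \<in> carrier A" if "x \<in> carrier A" for x
    using rb that by (auto simp: rota_baxter_group_def)
  have C [simp]: "x \<otimes>\<^bsub>C\<^esub> y \<in> carrier A" if "x \<in> carrier A" "y \<in> carrier A" for x y
    using that by (simp add: mult)
  have BC: "B (x \<otimes>\<^bsub>C\<^esub> y) = B x \<otimes> B y" if "x \<in> carrier A" "y \<in> carrier A" for x y
    using rb that by (simp add: mult rota_baxter_group_def)
  \<comment> \<open>After \<open>m_assoc\<close> has nested products to the right, an element next
    to its inverse appears in one of these two shapes.\<close>
  have cancel [simp]: "inv x \<otimes> (x \<otimes> y) = y" "x \<otimes> (inv x \<otimes> y) = y"
    if "x \<in> carrier A" "y \<in> carrier A" for x y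
    using that by (simp_all flip: m_assoc)
  have "group C"
  \<comment> \<open>A left unit and left inverses suffice here.\<close>
  proof (rule groupI, unfold carr one)
    fix x y z assume xyz: "x \<in> carrier A" "y \<in> carrier A" "z \<in> carrier A"
    \<comment> \<open>Only the outer product is expanded, so that \<open>BC\<close> can still match
      \<open>B\<close> of the inner one.\<close>
    have "(x \<otimes>\<^bsub>C\<^esub> y) \<otimes>\<^bsub>C\<^esub> z = (x \<otimes>\<^bsub>C\<^esub> y) \<otimes> (B x \<otimes> B y) \<otimes> z \<otimes> inv (B x \<otimes> B y)"
      using xyz by (simp add: mult [of "x \<otimes>\<^bsub>C\<^esub> y"] BC)
    also have "\<dots> = x \<otimes>\<^bsub>C\<^esub> (y \<otimes>\<^bsub>C\<^esub> z)"
      using xyz by (simp add: mult m_assoc inv_mult_group)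
    finally show "(x \<otimes>\<^bsub>C\<^esub> y) \<otimes>\<^bsub>C\<^esub> z = x \<otimes>\<^bsub>C\<^esub> (y \<otimes>\<^bsub>C\<^esub> z)" .
  next
    fix x assume x: "x \<in> carrier A"
    show "\<one> \<otimes>\<^bsub>C\<^esub> x = x"
      using x by (simp add: mult rota_baxter_group_one [OF rb])
    \<comment> \<open>Solving
      \<open>x \<otimes> B x \<otimes> x' \<otimes> inv (B x) = \<one>\<close> for \<open>x'\<close>
      gives this value, the formula of \<open>descendant_inv\<close>.\<close>
    define x' where "x' = inv (B x) \<otimes> inv x \<otimes> B x"
    have x': "x' \<in> carrier A" using x by (simp add: x'_def)
    have "x \<otimes>\<^bsub>C\<^esub> x' = \<one>"
      using x by (simp add: mult x'_def m_assoc)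
    then have "B x \<otimes> B x' = \<one>"
      using BC [OF x x'] by (simp add: rota_baxter_group_one [OF rb])
    then have "B x' = inv (B x)"
      using x x' by (metis B inv_comm inv_equality)
    \<comment> \<open>The first \<open>simp\<close> replaces \<open>B x'\<close> by
      \<open>inv (B x)\<close>; only then is \<open>x'\<close> unfolded, and the word
      cancels.\<close>
    then have "x' \<otimes>\<^bsub>C\<^esub> x = \<one>"
      using x x' by (simp add: mult) (simp add: x'_def m_assoc)
    then show "\<exists>y\<in>carrier A. y \<otimes>\<^bsub>C\<^esub> x = \<one>" using x' by blast
  qed simp_all
  \<comment> \<open>On the right, \<open>inv a\<close> cancels the \<open>a\<close> that follows it,
    and then \<open>inv (B a)\<close> meets \<open>B a\<close>.\<close>
  moreover have "a \<otimes>\<^bsub>C\<^esub> (b \<otimes> c) = (a \<otimes>\<^bsub>C\<^esub> b) \<otimes> inv a \<otimes> (a \<otimes>\<^bsub>C\<^esub> c)"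
    if "a \<in> carrier A" "b \<in> carrier A" "c \<in> carrier A" for a b c
    using that by (simp add: mult m_assoc)
  ultimately show ?thesis
    using carr by (simp add: skew_brace_def)
qed

lemma nat_trans_closed:
  "\<lbrakk>nat_trans k F G \<alpha>; R \<in> Alg k; x \<in> on_objs F R\<rbrakk> \<Longrightarrow> \<alpha> R x \<in> on_objs G R"
  by (auto simp: nat_trans_def)

lemma nat_trans_natural:
  "\<lbrakk>nat_trans k F G \<alpha>; R \<in> Alg k; S \<in> Alg k; f \<in> alg_hom k R S; x \<in> on_objs F R\<rbrakk>
    \<Longrightarrow> \<alpha> S (on_homs F R S f x) = on_homs G R S f (\<alpha> R x)"
  by (auto simp: nat_trans_def)

lemma on_objs_prod_functor [simp]:
  "on_objs (prod_functor F G) R = on_objs F R \<times> on_objs G R"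
  by (simp add: prod_functor_def)

lemma on_homs_prod_functor [simp]:
  "on_homs (prod_functor F G) R S f (x, y) = (on_homs F R S f x, on_homs G R S f y)"
  by (simp add: prod_functor_def)

lemma carrier_points [simp]: "carrier (points G m e R) = on_objs G R"
  and mult_points [simp]: "x \<otimes>\<^bsub>points G m e R\<^esub> y = m R (x, y)"
  and one_points [simp]: "\<one>\<^bsub>points G m e R\<^esub> = e R"
  by (simp_all add: points_def)

text \<open>The descendant product contains \<open>iv\<close>, so its naturality rests on
  this.\<close>

lemma nat_trans_inv:
  assumes F: "is_functor k G" and m: "nat_trans k (prod_functor G G) G m"
    and grp: "\<And>R. R \<in> Alg k \<Longrightarrow> group (points G m e R)"
    and iv: "\<And>R x. \<lbrakk>R \<in> Alg k; x \<in> on_objs G R\<rbrakk> \<Longrightarrow> iv R x = inv\<^bsub>points G m e R\<^esub> x"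
  shows "nat_trans k G G iv"
  unfolding nat_trans_def
proof (intro conjI ballI funcsetI)
  fix R x assume "R \<in> Alg k" "x \<in> on_objs G R"
  then show "iv R x \<in> on_objs G R"
    using group.inv_closed [OF grp, of R x] by (simp add: iv)
next
  fix R S f x
  assume R: "R \<in> Alg k" and S: "S \<in> Alg k" and f: "f \<in> alg_hom k R S" and x: "x \<in> on_objs G R"
  have Ff: "on_homs G R S f \<in> on_objs G R \<rightarrow> on_objs G S"
    using F R S f by (auto simp: is_functor_def)
  \<comment> \<open>Naturality of \<open>m\<close> at a pair is exactly multiplicativity of the
    functor's map; between groups this already forces inverses to be preserved.\<close>
  have "group_hom (points G m e R) (points G m e S) (on_homs G R S f)"
    using Ff nat_trans_natural [OF m R S f, of "(_, _)"]
    by (simp add: group_hom_def group_hom_axioms_def grp R S hom_def)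
  from group_hom.hom_inv [OF this, of x]
  show "iv S (on_homs G R S f x) = on_homs G R S f (iv R x)"
    using R S x funcset_mem [OF Ff x] by (simp add: iv)
qed

lemma nat_trans_descendant_mult:
  assumes m: "nat_trans k (prod_functor G G) G m"
    and B: "nat_trans k G G B" and iv: "nat_trans k G G iv"
  shows "nat_trans k (prod_functor G G) G (descendant_mult m iv B)"
proof -
  have mc: "m R (x, y) \<in> on_objs G R" if "R \<in> Alg k" "x \<in> on_objs G R" "y \<in> on_objs G R" for R x y
    using nat_trans_closed [OF m] that by simp
  have mn: "m S (on_homs G R S f x, on_homs G R S f y) = on_homs G R S f (m R (x, y))"
    if "R \<in> Alg k" "S \<in> Alg k" "f \<in> alg_hom k R S" "x \<in> on_objs G R" "y \<in> on_objs G R" for R S f x y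
    using nat_trans_natural [OF m, of R S f "(x, y)"] that by simp
  note closed = mc nat_trans_closed [OF B] nat_trans_closed [OF iv]
  \<comment> \<open>Used from left to right, these equations move the functor's map outwards through
    each operation in turn.\<close>
  note natural = mn nat_trans_natural [OF B] nat_trans_natural [OF iv]
  show ?thesis
    unfolding nat_trans_def by (auto simp: descendant_mult_def closed natural)
qed

theorem proposition5p1:
  fixes k :: "'k ring"
    and G :: "('k, 'u, 'x) set_functor"
    and m mB :: "('k, 'u) module \<Rightarrow> 'x \<times> 'x \<Rightarrow> 'x"
    and e :: "('k, 'u) module \<Rightarrow> 'x"
    and iv ivB B :: "('k, 'u) module \<Rightarrow> 'x \<Rightarrow> 'x"
  assumes "field k"
    and "affine_rota_baxter_group k G m e iv B"
    and "descendant_affine_group G m e iv B = (G, mB, e, ivB)"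
  shows "affine_skew_brace k G m mB"
proof -
  have mB: "mB = descendant_mult m iv B"
    using assms(3) by (simp add: descendant_affine_group_def)
  have rep: "representable k G" and m: "nat_trans k (prod_functor G G) G m"
    and B: "nat_trans k G G B"
    and rb: "\<And>R. R \<in> Alg k \<Longrightarrow> rota_baxter_group (points G m e R) (B R)"
    and iv: "\<And>R x. \<lbrakk>R \<in> Alg k; x \<in> on_objs G R\<rbrakk> \<Longrightarrow> iv R x = inv\<^bsub>points G m e R\<^esub> x"
    using assms(2) by (auto simp: affine_rota_baxter_group_def)
  have F: "is_functor k G" using rep by (simp add: representable_def)
  have "nat_trans k G G iv"
    using nat_trans_inv [OF F m _ iv] rb by (simp add: rota_baxter_group_def)
  then have "nat_trans k (prod_functor G G) G mB"
    unfolding mB by (rule nat_trans_descendant_mult [OF m B])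
  \<comment> \<open>Both groups have the unit \<open>e R\<close>, which is the witness for both
    existential quantifiers.\<close>
  moreover have "skew_brace (points G m e R) (points G mB e R)" if R: "R \<in> Alg k" for R
    by (rule skew_brace_descendant [OF rb [OF R]])
      (simp_all add: mB descendant_mult_def iv R nat_trans_closed [OF B])
  ultimately show ?thesis
    using rep m by (auto simp: affine_skew_brace_def)
qed

end
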